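(* Let $l,m,n\in\omega$ with $l>n$ and $m>n$, and let $\varphi$ be a sentence. Then the following three theories are equivalent, i.e. have the same theorems: $$\mathcal{U}+\Pi_l\text{-}\mathsf{RR}^n(\mathcal{U}+\varphi)\ \equiv\ \mathcal{U}+\Pi_m\text{-}\mathsf{RR}^n(\mathcal{U}+\varphi)\ \equiv\ \mathcal{U}+\{Q^k_n(\varphi)\mid k\in\omega\}.$$
   Context: Setting. $\mathcal{U}$ is a theory in which metamathematical notions can be formalized in the usual way (as in Elementary Arithmetic), and $([n]_{\mathcal{U}})_{n\in\omega}$ is a series of provability predicates over $\mathcal{U}$. For each theory $\mathcal{U}+\varphi$ there are likewise predicates $[n]_{\mathcal{U}+\varphi}$. We write $[n]$ for $[n]_{\mathcal{U}}$, and $\langle n\rangle\psi:=\neg[n]\neg\psi$ (also written $\langle n\rangle_{\mathcal{U}}\psi$). Free variables inside $[n]$ or $\langle n\rangle$ are treated as parameters: for a formula $\psi(x)$, $[n]\psi$ means $[n]\psi(\dot x)$, the formula with free variable $x$ saying that $\psi(\overline{x})$ is $[n]$-provable, where $\overline{x}$ is the numeral of $x$. Standing assumptions. (1) The predicates are sound for the polymodal provability logic $\mathsf{GLP}$. That is, for all formulas $A,B$ of the language of $\mathcal{U}$, $\mathcal{U}$ proves - $[i](A\to B)\to([i]A\to[i]B)$ and $[i]([i]A\to A)\to[i]A$ for all $i\in\omega$; - $[i]A\to[j]A$ for $i\le j$; - $\langle i\rangle A\to[j]\langle i\rangle A$ for $i<j$; and $\mathcal{U}\vdash A$ implies $\mathcal{U}\vdash[i]A$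 (necessitation). (2) The formalized deduction theorem holds for each $n$: $\mathcal{U}\vdash[n]_{\mathcal{U}+\varphi}\psi$ if and only if $\mathcal{U}\vdash[n]_{\mathcal{U}}(\varphi\to\psi)$. (3) Every formula of the form $\langle n\rangle\psi$ is of complexity $\Pi_{n+1}$ (where $\Pi_m,\Sigma_m$ are the classes $\Pi^0_m,\Sigma^0_m$ of the usual arithmetical hierarchy). Reflection rule. $\Pi_m\text{-}\mathsf{RR}^n(\mathcal{U}+\varphi)$ is the inference rule $$\frac{\psi}{\langle n\rangle_{\mathcal{U}}(\varphi\wedge\psi)}\qquad(\psi\in\Pi_m).$$ $\mathcal{U}+\Pi_m\text{-}\mathsf{RR}^n(\mathcal{U}+\varphi)$ denotes the closure of $\mathcal{U}$ under this rule and first-order logic; the rule may be applied repeatedly to any already derived $\Pi_m$ formula. Formulas $Q^k_n$. $Q^0_n(\varphi):=\langle n\rangle_{\mathcal{U}}\varphi$ and $Q^{k+1}_n(\varphi):=\langle n\rangle_{\mathcal{U}}(\varphi\wedge Q^k_n(\varphi))$. *)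

theory Defs
  imports Main
begin

text \<open>First-order languages with equality that extend the language of arithmetic
  (0, successor, +, *, \<open>\<le>\<close>) by function symbols of type \<open>'f\<close> and predicate symbols of
  type \<open>'p\<close>. Variables are de Bruijn indices, and a free variable is an index that no
  quantifier captures.\<close>

datatype 'f tm =
    Var nat
  | Zero
  | Succ "'f tm"
  | Plus "'f tm" "'f tm"
  | Times "'f tm" "'f tm"
  | Fn 'f "'f tm list"

datatype ('f, 'p) fm =
    Eq "'f tm" "'f tm"
  | Le "'f tm" "'f tm"
  | Pr 'p "'f tm list"
  | Bot
  | Imp "('f, 'p) fm" "('f, 'p) fm"
  | Forall "('f, 'p) fm"

abbreviation "Neg A \<equiv> Imp A Bot"
abbreviation "And A B \<equiv> Neg (Imp A (Neg B))"
abbreviation "Iff A B \<equiv> And (Imp A B) (Imp B A)"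
abbreviation "Exists A \<equiv> Neg (Forall (Neg A))"

text \<open>A language is the set of its additional function and predicate symbols, each with its
  arity. The pure language of arithmetic is \<open>({}, {})\<close>.\<close>

type_synonym ('f, 'p) lang = "('f \<times> nat) set \<times> ('p \<times> nat) set"

fun wf_tm :: "('f, 'p) lang \<Rightarrow> 'f tm \<Rightarrow> bool" where
  "wf_tm L (Var i) \<longleftrightarrow> True"
| "wf_tm L Zero \<longleftrightarrow> True"
| "wf_tm L (Succ t) \<longleftrightarrow> wf_tm L t"
| "wf_tm L (Plus s t) \<longleftrightarrow> wf_tm L s \<and> wf_tm L t"
| "wf_tm L (Times s t) \<longleftrightarrow> wf_tm L s \<and> wf_tm L t"
| "wf_tm L (Fn f ts) \<longleftrightarrow> (f, length ts) \<in> fst L \<and> (\<forall>t\<in>set ts. wf_tm L t)"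

fun wf_fm :: "('f, 'p) lang \<Rightarrow> ('f, 'p) fm \<Rightarrow> bool" where
  "wf_fm L (Eq s t) \<longleftrightarrow> wf_tm L s \<and> wf_tm L t"
| "wf_fm L (Le s t) \<longleftrightarrow> wf_tm L s \<and> wf_tm L t"
| "wf_fm L (Pr p ts) \<longleftrightarrow> (p, length ts) \<in> snd L \<and> (\<forall>t\<in>set ts. wf_tm L t)"
| "wf_fm L Bot \<longleftrightarrow> True"
| "wf_fm L (Imp A B) \<longleftrightarrow> wf_fm L A \<and> wf_fm L B"
| "wf_fm L (Forall A) \<longleftrightarrow> wf_fm L A"

fun fv_tm :: "'f tm \<Rightarrow> nat set" where
  "fv_tm (Var i) = {i}"
| "fv_tm Zero = {}"
| "fv_tm (Succ t) = fv_tm t"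
| "fv_tm (Plus s t) = fv_tm s \<union> fv_tm t"
| "fv_tm (Times s t) = fv_tm s \<union> fv_tm t"
| "fv_tm (Fn f ts) = (\<Union>t\<in>set ts. fv_tm t)"

fun fv :: "('f, 'p) fm \<Rightarrow> nat set" where
  "fv (Eq s t) = fv_tm s \<union> fv_tm t"
| "fv (Le s t) = fv_tm s \<union> fv_tm t"
| "fv (Pr p ts) = (\<Union>t\<in>set ts. fv_tm t)"
| "fv Bot = {}"
| "fv (Imp A B) = fv A \<union> fv B"
| "fv (Forall A) = {i. Suc i \<in> fv A}"

definition sentence :: "('f, 'p) lang \<Rightarrow> ('f, 'p) fm \<Rightarrow> bool" where
  "sentence L A \<longleftrightarrow> wf_fm L A \<and> fv A = {}"

text \<open>Simultaneous capture-avoiding substitution\<close>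

fun subst_tm :: "(nat \<Rightarrow> 'f tm) \<Rightarrow> 'f tm \<Rightarrow> 'f tm" where
  "subst_tm \<sigma> (Var i) = \<sigma> i"
| "subst_tm \<sigma> Zero = Zero"
| "subst_tm \<sigma> (Succ t) = Succ (subst_tm \<sigma> t)"
| "subst_tm \<sigma> (Plus s t) = Plus (subst_tm \<sigma> s) (subst_tm \<sigma> t)"
| "subst_tm \<sigma> (Times s t) = Times (subst_tm \<sigma> s) (subst_tm \<sigma> t)"
| "subst_tm \<sigma> (Fn f ts) = Fn f (map (subst_tm \<sigma>) ts)"

abbreviation lift_tm :: "'f tm \<Rightarrow> 'f tm" where
  "lift_tm \<equiv> subst_tm (\<lambda>i. Var (Suc i))"

fun subst :: "(nat \<Rightarrow> 'f tm) \<Rightarrow> ('f, 'p) fm \<Rightarrow> ('f, 'p) fm" where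
  "subst \<sigma> (Eq s t) = Eq (subst_tm \<sigma> s) (subst_tm \<sigma> t)"
| "subst \<sigma> (Le s t) = Le (subst_tm \<sigma> s) (subst_tm \<sigma> t)"
| "subst \<sigma> (Pr p ts) = Pr p (map (subst_tm \<sigma>) ts)"
| "subst \<sigma> Bot = Bot"
| "subst \<sigma> (Imp A B) = Imp (subst \<sigma> A) (subst \<sigma> B)"
| "subst \<sigma> (Forall A) = Forall (subst (case_nat (Var 0) (\<lambda>i. lift_tm (\<sigma> i))) A)"

abbreviation lift :: "('f, 'p) fm \<Rightarrow> ('f, 'p) fm" where
  "lift \<equiv> subst (\<lambda>i. Var (Suc i))"

abbreviation inst :: "'f tm \<Rightarrow> ('f, 'p) fm \<Rightarrow> ('f, 'p) fm" where
  "inst t \<equiv> subst (case_nat t Var)"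

fun num :: "nat \<Rightarrow> 'f tm" where
  "num 0 = Zero"
| "num (Suc k) = Succ (num k)"

inductive log_axiom :: "('f, 'p) fm \<Rightarrow> bool" where
  "log_axiom (Imp A (Imp B A))"
| "log_axiom (Imp (Imp A (Imp B C)) (Imp (Imp A B) (Imp A C)))"
| "log_axiom (Imp (Neg (Neg A)) A)"
| "log_axiom (Imp (Forall A) (inst t A))"
| "log_axiom (Imp (Forall (Imp (lift A) B)) (Imp A (Forall B)))"
| "log_axiom (Eq t t)"
| "log_axiom (Imp (Eq s t) (Imp (inst s A) (inst t A)))"

text \<open>\<open>closure L T R\<close> consists of the formulas of the language \<open>L\<close> derivable from \<open>T\<close> by
  first-order logic and the additional inference rules \<open>R\<close>, a set of pairs (premise, conclusion);
  a rule applies to any formula already derived.\<close>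

inductive_set closure ::
  "('f, 'p) lang \<Rightarrow> ('f, 'p) fm set \<Rightarrow> (('f, 'p) fm \<times> ('f, 'p) fm) set \<Rightarrow> ('f, 'p) fm set"
  for L T R where
  axiom: "A \<in> T \<Longrightarrow> A \<in> closure L T R"
| logic: "log_axiom A \<Longrightarrow> wf_fm L A \<Longrightarrow> A \<in> closure L T R"
| mp: "Imp A B \<in> closure L T R \<Longrightarrow> A \<in> closure L T R \<Longrightarrow> B \<in> closure L T R"
| gen: "A \<in> closure L T R \<Longrightarrow> Forall A \<in> closure L T R"
| rule: "(A, B) \<in> R \<Longrightarrow> A \<in> closure L T R \<Longrightarrow> B \<in> closure L T R"

abbreviation theorems :: "('f, 'p) lang \<Rightarrow> ('f, 'p) fm set \<Rightarrow> ('f, 'p) fm set" where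
  "theorems L T \<equiv> closure L T {}"

text \<open>The axioms of Robinson arithmetic in the language with \<open>\<le>\<close>\<close>

definition robinson :: "('f, 'p) fm set" where
  "robinson =
    {Neg (Eq (Succ (Var 0)) Zero),
     Imp (Eq (Succ (Var 0)) (Succ (Var 1))) (Eq (Var 0) (Var 1)),
     Imp (Neg (Eq (Var 0) Zero)) (Exists (Eq (Var 1) (Succ (Var 0)))),
     Eq (Plus (Var 0) Zero) (Var 0),
     Eq (Plus (Var 0) (Succ (Var 1))) (Succ (Plus (Var 0) (Var 1))),
     Eq (Times (Var 0) Zero) Zero,
     Eq (Times (Var 0) (Succ (Var 1))) (Plus (Times (Var 0) (Var 1)) (Var 0)),
     Iff (Le (Var 0) (Var 1)) (Exists (Eq (Plus (Var 0) (Var 1)) (Var 2)))}"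

text \<open>The arithmetical hierarchy. Bounded existential and blocks of existential quantifiers
  come with \<open>Exists\<close> as an abbreviation for \<open>\<not>\<forall>\<not>\<close>. In \<open>ball\<close>, the bound is lifted so that
  it cannot contain the quantified variable.\<close>

fun arith_tm :: "'f tm \<Rightarrow> bool" where
  "arith_tm (Var i) \<longleftrightarrow> True"
| "arith_tm Zero \<longleftrightarrow> True"
| "arith_tm (Succ t) \<longleftrightarrow> arith_tm t"
| "arith_tm (Plus s t) \<longleftrightarrow> arith_tm s \<and> arith_tm t"
| "arith_tm (Times s t) \<longleftrightarrow> arith_tm s \<and> arith_tm t"
| "arith_tm (Fn f ts) \<longleftrightarrow> False"

inductive bounded :: "('f, 'p) fm \<Rightarrow> bool" where
  eq: "arith_tm s \<Longrightarrow> arith_tm t \<Longrightarrow> bounded (Eq s t)"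
| le: "arith_tm s \<Longrightarrow> arith_tm t \<Longrightarrow> bounded (Le s t)"
| bot: "bounded Bot"
| imp: "bounded A \<Longrightarrow> bounded B \<Longrightarrow> bounded (Imp A B)"
| ball: "arith_tm t \<Longrightarrow> bounded A \<Longrightarrow> bounded (Forall (Imp (Le (Var 0) (lift_tm t)) A))"

inductive strict_Sigma :: "nat \<Rightarrow> ('f, 'p) fm \<Rightarrow> bool"
  and strict_Pi :: "nat \<Rightarrow> ('f, 'p) fm \<Rightarrow> bool" where
  "bounded A \<Longrightarrow> strict_Sigma 0 A"
| "bounded A \<Longrightarrow> strict_Pi 0 A"
| "strict_Pi m A \<Longrightarrow> strict_Sigma (Suc m) A"
| "strict_Sigma (Suc m) A \<Longrightarrow> strict_Sigma (Suc m) (Exists A)"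
| "strict_Sigma m A \<Longrightarrow> strict_Pi (Suc m) A"
| "strict_Pi (Suc m) A \<Longrightarrow> strict_Pi (Suc m) (Forall A)"

text \<open>As usual, a formula counts as \<open>\<Pi>\<^sub>m\<close> when it is of the strict form up to equivalence in
  the base theory.\<close>

definition Pi_class :: "('f, 'p) lang \<Rightarrow> ('f, 'p) fm set \<Rightarrow> nat \<Rightarrow> ('f, 'p) fm set" where
  "Pi_class L U m = {A. wf_fm L A \<and> (\<exists>B. strict_Pi m B \<and> Iff A B \<in> theorems L U)}"

text \<open>Formulas \<open>P\<close> with at most the variable 0 free serve as provability predicates. For
  \<open>A\<close> with free variables among \<open>x\<^sub>0, x\<^sub>1, ...\<close>, the formula \<open>D A\<close>
  expresses that \<open>y\<close> is the code of the result of replacing each free variable of \<open>A\<close> by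
  the numeral of its value; in it, \<open>y\<close> is index 0 and \<open>x\<^sub>i\<close> is index \<open>Suc i\<close>.
  So \<open>box D P A\<close> has the same parameters as \<open>A\<close> and says
  \<open>\<exists>y. D A (y, x\<^sub>0, x\<^sub>1, ...) \<and> P(y)\<close>, that is, \<open>P\<close> holds of the code of
  the dotted \<open>A\<close>.\<close>

definition box :: "(('f, 'p) fm \<Rightarrow> ('f, 'p) fm) \<Rightarrow> ('f, 'p) fm \<Rightarrow> ('f, 'p) fm \<Rightarrow> ('f, 'p) fm" where
  "box D P A = Exists (And (D A) P)"

definition dia :: "(('f, 'p) fm \<Rightarrow> ('f, 'p) fm) \<Rightarrow> ('f, 'p) fm \<Rightarrow> ('f, 'p) fm \<Rightarrow> ('f, 'p) fm" where
  "dia D P A = Neg (box D P (Neg A))"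

text \<open>What is required of the formalization of syntax in \<open>U\<close>, with \<open>gn\<close> the numbering of formulas:
  \<open>D\<close> provably defines total functions and has the correct values on numerals.\<close>

locale formalized_syntax =
  fixes L :: "('f, 'p) lang"
    and U :: "('f, 'p) fm set"
    and gn :: "('f, 'p) fm \<Rightarrow> nat"
    and D :: "('f, 'p) fm \<Rightarrow> ('f, 'p) fm"
  assumes U_sentences: "A \<in> U \<Longrightarrow> sentence L A"
    and U_robinson: "robinson \<subseteq> theorems L U"
    and gn_inj: "inj_on gn {A. wf_fm L A}"
    and D_wf: "wf_fm L A \<Longrightarrow> wf_fm L (D A)"
    and D_fv: "wf_fm L A \<Longrightarrow> fv (D A) \<subseteq> insert 0 (Suc ` fv A)"
    and D_total: "wf_fm L A \<Longrightarrow> Exists (D A) \<in> theorems L U"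
    and D_functional: "wf_fm L A \<Longrightarrow>
      Imp (And (subst (case_nat (Var 0) (\<lambda>i. Var (Suc (Suc i)))) (D A))
               (subst (case_nat (Var 1) (\<lambda>i. Var (Suc (Suc i)))) (D A)))
          (Eq (Var 0) (Var 1)) \<in> theorems L U"
    and D_numerals: "wf_fm L A \<Longrightarrow>
      subst (case_nat (num (gn (subst (\<lambda>i. num (e i)) A))) (\<lambda>i. num (e i))) (D A)
        \<in> theorems L U"

text \<open>\<open>Prv n\<close> is the \<open>n\<close>-th provability predicate over \<open>U\<close> and \<open>PrvE \<chi> n\<close>
  the one over \<open>U + \<chi>\<close>.\<close>

locale provability_series = formalized_syntax L U gn D
  for L :: "('f, 'p) lang"
    and U :: "('f, 'p) fm set"
    and gn :: "('f, 'p) fm \<Rightarrow> nat"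
    and D :: "('f, 'p) fm \<Rightarrow> ('f, 'p) fm" +
  fixes Prv :: "nat \<Rightarrow> ('f, 'p) fm"
    and PrvE :: "('f, 'p) fm \<Rightarrow> nat \<Rightarrow> ('f, 'p) fm"
  assumes Prv_predicate: "wf_fm L (Prv n)" "fv (Prv n) \<subseteq> {0}"
    and PrvE_predicate:
      "sentence L \<chi> \<Longrightarrow> wf_fm L (PrvE \<chi> n)" "sentence L \<chi> \<Longrightarrow> fv (PrvE \<chi> n) \<subseteq> {0}"
    and distribution: "wf_fm L A \<Longrightarrow> wf_fm L B \<Longrightarrow>
      Imp (box D (Prv i) (Imp A B)) (Imp (box D (Prv i) A) (box D (Prv i) B)) \<in> theorems L U"
    and loeb: "wf_fm L A \<Longrightarrow>
      Imp (box D (Prv i) (Imp (box D (Prv i) A) A)) (box D (Prv i) A) \<in> theorems L U"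
    and monotonicity: "wf_fm L A \<Longrightarrow> i \<le> j \<Longrightarrow>
      Imp (box D (Prv i) A) (box D (Prv j) A) \<in> theorems L U"
    and negative_introspection: "wf_fm L A \<Longrightarrow> i < j \<Longrightarrow>
      Imp (dia D (Prv i) A) (box D (Prv j) (dia D (Prv i) A)) \<in> theorems L U"
    and necessitation: "A \<in> theorems L U \<Longrightarrow> box D (Prv i) A \<in> theorems L U"
    and formalized_deduction: "sentence L \<chi> \<Longrightarrow> wf_fm L A \<Longrightarrow>
      box D (PrvE \<chi> n) A \<in> theorems L U \<longleftrightarrow> box D (Prv n) (Imp \<chi> A) \<in> theorems L U"
    and complexity: "wf_fm L A \<Longrightarrow> dia D (Prv n) A \<in> Pi_class L U (Suc n)"

text \<open>The rule \<open>\<Pi>\<^sub>m\<close>-\<open>RR\<^sup>n(U + \<phi>)\<close>, with \<open>P\<close> the \<open>n\<close>-th provability predicate over \<open>U\<close>\<close>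

definition RR :: "('f, 'p) lang \<Rightarrow> ('f, 'p) fm set \<Rightarrow> (('f, 'p) fm \<Rightarrow> ('f, 'p) fm) \<Rightarrow>
    ('f, 'p) fm \<Rightarrow> nat \<Rightarrow> ('f, 'p) fm \<Rightarrow> (('f, 'p) fm \<times> ('f, 'p) fm) set" where
  "RR L U D P m \<phi> = {(\<psi>, dia D P (And \<phi> \<psi>)) | \<psi>. \<psi> \<in> Pi_class L U m}"

primrec Q :: "(('f, 'p) fm \<Rightarrow> ('f, 'p) fm) \<Rightarrow> ('f, 'p) fm \<Rightarrow> nat \<Rightarrow> ('f, 'p) fm \<Rightarrow> ('f, 'p) fm" where
  "Q D P 0 \<phi> = dia D P \<phi>"
| "Q D P (Suc k) \<phi> = dia D P (And \<phi> (Q D P k \<phi>))"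

end

theory Submission
  imports Defs
begin

text \<open>Write \<open>\<langle>n\<rangle>\<close> for the dual of the \<open>n\<close>-th provability predicate and \<open>Q\<^sub>k\<close> for the
  \<open>k\<close>-th iterate \<open>\<langle>n\<rangle>(\<phi> \<and> \<langle>n\<rangle>(\<phi> \<and> \<dots>))\<close>. Each closure under the reflection rule
  coincides with \<open>U + {Q\<^sub>k | k}\<close>.

  The iterates are derivable by the rule (\<open>Q_in_closure_RR\<close>): \<open>Q\<^sub>0\<close> results from applying it
  to a trivial premise and \<open>Q\<^sub>k\<^sub>+\<^sub>1\<close> from applying it to \<open>Q\<^sub>k\<close>. This is where the class has to
  be large enough: \<open>Q\<^sub>k\<close> is \<open>\<Pi>\<^sub>n\<^sub>+\<^sub>1\<close>, hence \<open>\<Pi>\<^sub>m\<close> for every \<open>m > n\<close>.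

  Conversely, \<open>U + {Q\<^sub>k | k}\<close> is closed under the rule, whatever the complexity of the
  premise (\<open>Q_theory_closed_under_RR\<close>). The \<open>Q\<^sub>k\<close> are sentences of increasing strength, so
  that by compactness and the deduction theorem a derivation of \<open>\<psi>\<close> uses a single one of
  them: \<open>U\<close> proves \<open>Q\<^sub>k \<rightarrow> \<psi>\<close> (\<open>chain_compactness\<close>). Since \<open>\<langle>n\<rangle>\<close> is monotone with respect to
  provable implication (\<open>dia_mono\<close>), \<open>U\<close> proves
  \<open>\<langle>n\<rangle>(\<phi> \<and> Q\<^sub>k) \<rightarrow> \<langle>n\<rangle>(\<phi> \<and> \<psi>)\<close>, whose antecedent is \<open>Q\<^sub>k\<^sub>+\<^sub>1\<close>.\<close>

section \<open>Substitution in sentences\<close>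

lemma subst_tm_id: "(\<And>i. i \<in> fv_tm t \<Longrightarrow> \<sigma> i = Var i) \<Longrightarrow> subst_tm \<sigma> t = t"
  by (induction t) (auto intro!: map_idI)

lemma subst_id: "(\<And>i. i \<in> fv A \<Longrightarrow> \<sigma> i = Var i) \<Longrightarrow> subst \<sigma> A = A"
proof (induction A arbitrary: \<sigma>)
  case (Pr p ts)
  then show ?case by (auto intro!: map_idI subst_tm_id)
next
  case (Forall A)
  show ?case
    unfolding subst.simps
    by (subst Forall.IH) (use Forall.prems in \<open>auto split: nat.split\<close>)
qed (auto intro: subst_tm_id)

lemma lift_sentence: "sentence L A \<Longrightarrow> lift A = A"
  by (rule subst_id) (simp add: sentence_def)

section \<open>Hilbert-style derivations\<close>

lemma closure_mono:
  assumes "A \<in> closure L T R" "T \<subseteq> T'" "R \<subseteq> R'"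
  shows "A \<in> closure L T' R'"
  using assms(1)
  by induction (use assms(2,3) in \<open>auto intro: closure.intros\<close>)

text \<open>When the axioms belong to the language, so does every theorem. In the derivations below,
  well-formedness therefore has to be assumed only for formulas that no premise contains.\<close>

locale wf_theory =
  fixes L :: "('f, 'p) lang" and T :: "('f, 'p) fm set"
  assumes wf_axioms: "A \<in> T \<Longrightarrow> wf_fm L A"
begin

lemma wf_theorem: "A \<in> theorems L T \<Longrightarrow> wf_fm L A"
  by (induction rule: closure.induct) (auto simp: wf_axioms)

lemma imp_weaken:
  assumes "B \<in> theorems L T" "wf_fm L A"
  shows "Imp A B \<in> theorems L T"
proof -
  have "Imp B (Imp A B) \<in> theorems L T"
    using assms wf_theorem by (intro closure.logic log_axiom.intros) auto
  then show ?thesis using assms(1) by (rule closure.mp)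
qed

lemma imp_mp:
  assumes "Imp A (Imp B C) \<in> theorems L T" "Imp A B \<in> theorems L T"
  shows "Imp A C \<in> theorems L T"
proof -
  have "Imp (Imp A (Imp B C)) (Imp (Imp A B) (Imp A C)) \<in> theorems L T"
    using wf_theorem[OF assms(1)] by (intro closure.logic log_axiom.intros) auto
  then show ?thesis using assms by (blast intro: closure.mp)
qed

lemma imp_trans:
  assumes "Imp A B \<in> theorems L T" "Imp B C \<in> theorems L T"
  shows "Imp A C \<in> theorems L T"
  using wf_theorem[OF assms(1)] by (intro imp_mp[OF imp_weaken[OF assms(2)] assms(1)]) auto

lemma imp_refl:
  assumes "wf_fm L A"
  shows "Imp A A \<in> theorems L T"
proof -
  have "Imp A (Imp (Imp A A) A) \<in> theorems L T" "Imp A (Imp A A) \<in> theorems L T"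
    using assms by (auto intro!: closure.logic log_axiom.intros)
  then show ?thesis by (rule imp_mp)
qed

lemma imp_compose:
  assumes "Imp A B \<in> theorems L T" "wf_fm L C"
  shows "Imp (Imp C A) (Imp C B) \<in> theorems L T"
proof -
  have "Imp (Imp C (Imp A B)) (Imp (Imp C A) (Imp C B)) \<in> theorems L T"
    using wf_theorem[OF assms(1)] assms(2) by (intro closure.logic log_axiom.intros) auto
  then show ?thesis using imp_weaken[OF assms] by (rule closure.mp)
qed

lemma imp_contrapos:
  assumes "Imp A B \<in> theorems L T"
  shows "Imp (Neg B) (Neg A) \<in> theorems L T"
proof -
  have wf: "wf_fm L A" "wf_fm L B" using wf_theorem[OF assms] by auto
  have "Imp (Neg B) (Imp A (Neg B)) \<in> theorems L T"
    using wf by (intro closure.logic log_axiom.intros) auto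
  moreover have "Imp (Imp A (Neg B)) (Imp (Imp A B) (Neg A)) \<in> theorems L T"
    using wf by (intro closure.logic log_axiom.intros) auto
  ultimately have "Imp (Neg B) (Imp (Imp A B) (Neg A)) \<in> theorems L T"
    by (rule imp_trans)
  then show ?thesis
    by (rule imp_mp) (use wf in \<open>auto intro: imp_weaken assms\<close>)
qed

lemma ex_falso:
  assumes "wf_fm L A"
  shows "Imp Bot A \<in> theorems L T"
proof -
  have "Imp Bot (Neg (Neg A)) \<in> theorems L T" "Imp (Neg (Neg A)) A \<in> theorems L T"
    using assms by (auto intro!: closure.logic log_axiom.intros)
  then show ?thesis by (rule imp_trans)
qed

lemma and_mono:
  assumes "Imp A B \<in> theorems L T" "wf_fm L C"
  shows "Imp (And C A) (And C B) \<in> theorems L T"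
  using assms by (intro imp_contrapos imp_compose)

lemma and_left:
  assumes "wf_fm L A" "wf_fm L B"
  shows "Imp (And A B) A \<in> theorems L T"
proof -
  have "Imp (Neg A) (Imp A (Neg B)) \<in> theorems L T"
    using assms by (intro imp_compose ex_falso) auto
  then have "Imp (And A B) (Neg (Neg A)) \<in> theorems L T"
    by (rule imp_contrapos)
  moreover have "Imp (Neg (Neg A)) A \<in> theorems L T"
    using assms by (intro closure.logic log_axiom.intros) auto
  ultimately show ?thesis by (rule imp_trans)
qed

lemma imp_and_theorem:
  assumes "B \<in> theorems L T" "wf_fm L A"
  shows "Imp A (And A B) \<in> theorems L T"
proof -
  let ?P = "Imp A (Neg B)"
  have wf: "wf_fm L B" using assms(1) by (rule wf_theorem)
  have "Imp A (Imp ?P A) \<in> theorems L T"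
    using assms(2) wf by (intro closure.logic log_axiom.intros) auto
  moreover have "Imp (Imp ?P A) (Imp ?P (Neg B)) \<in> theorems L T"
  proof -
    have "Imp ?P ?P \<in> theorems L T" using assms(2) wf by (intro imp_refl) auto
    moreover have "Imp (Imp ?P ?P) (Imp (Imp ?P A) (Imp ?P (Neg B))) \<in> theorems L T"
      using assms(2) wf by (intro closure.logic log_axiom.intros) auto
    ultimately show ?thesis by (blast intro: closure.mp)
  qed
  moreover have "Imp (Imp ?P (Neg B)) (Neg ?P) \<in> theorems L T"
  proof -
    have "Imp (Neg B) (Neg B) \<in> theorems L T" using wf by (intro imp_refl) auto
    moreover have "Imp (Neg B) B \<in> theorems L T" using assms(1) wf by (intro imp_weaken) auto
    ultimately have "Imp (Neg B) Bot \<in> theorems L T" by (rule imp_mp)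
    then show ?thesis using assms(2) wf by (intro imp_compose) auto
  qed
  ultimately show ?thesis by (blast intro: imp_trans)
qed

lemma iff_refl:
  assumes "wf_fm L A"
  shows "Iff A A \<in> theorems L T"
proof -
  have "Imp A A \<in> theorems L T" using assms by (rule imp_refl)
  moreover from this have "Imp (Imp A A) (Iff A A) \<in> theorems L T"
    using wf_theorem by (intro imp_and_theorem)
  ultimately show ?thesis by (blast intro: closure.mp)
qed

text \<open>Compactness and the deduction theorem in one: a derivation involves finitely many members
  of the chain, and the strongest of them can serve as the only hypothesis. Generalization
  passes the hypothesis because a sentence is fixed by the lifting that shifts its free
  variables.\<close>

lemma chain_compactness:
  fixes S :: "nat \<Rightarrow> ('f, 'p) fm"
  assumes sentences: "\<And>k. sentence L (S k)"
    and decreasing: "\<And>k. Imp (S (Suc k)) (S k) \<in> theorems L T"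
    and derivable: "A \<in> theorems L (T \<union> range S)"
  shows "\<exists>k. Imp (S k) A \<in> theorems L T"
proof -
  have wf: "wf_fm L (S k)" for k using sentences by (simp add: sentence_def)
  have chain: "Imp (S k) (S j) \<in> theorems L T" if "j \<le> k" for j k
    using that
    by (induction rule: dec_induct) (blast intro: imp_refl wf imp_trans decreasing)+
  show ?thesis
    using derivable
  proof induction
    case (axiom A)
    then show ?case using wf imp_refl imp_weaken closure.axiom by blast
  next
    case (logic A)
    then show ?case using wf imp_weaken closure.logic by blast
  next
    case (mp A B)
    then obtain j k where
      "Imp (S j) (Imp A B) \<in> theorems L T" "Imp (S k) A \<in> theorems L T" by blast
    then have "Imp (S (max j k)) (Imp A B) \<in> theorems L T"
      "Imp (S (max j k)) A \<in> theorems L T"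
      by (meson chain imp_trans max.cobounded1 max.cobounded2)+
    then show ?case by (blast intro: imp_mp)
  next
    case (gen A)
    then obtain k where k: "Imp (S k) A \<in> theorems L T" by blast
    have "log_axiom (Imp (Forall (Imp (lift (S k)) A)) (Imp (S k) (Forall A)))"
      by (rule log_axiom.intros)
    then have "log_axiom (Imp (Forall (Imp (S k) A)) (Imp (S k) (Forall A)))"
      by (simp add: lift_sentence[OF sentences])
    then have "Imp (Forall (Imp (S k) A)) (Imp (S k) (Forall A)) \<in> theorems L T"
      using wf_theorem[OF k] by (intro closure.logic) auto
    then show ?case using closure.gen[OF k] closure.mp by blast
  qed simp
qed

end

section \<open>Cumulativity of the arithmetical hierarchy\<close>

text \<open>No formation rule leads from \<open>\<Pi>\<^sub>m\<close> directly to \<open>\<Pi>\<^sub>m\<^sub>+\<^sub>1\<close>. The level is raised at the bounded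
  matrix instead, which counts as both \<open>\<Sigma>\<^sub>1\<close> and \<open>\<Pi>\<^sub>1\<close> with empty quantifier blocks, and
  all the blocks above it move up one level.\<close>

lemma strict_Sigma_Pi_Suc:
  "strict_Sigma m A \<Longrightarrow> strict_Sigma (Suc m) A"
  "strict_Pi m A \<Longrightarrow> strict_Pi (Suc m) A"
  by (induction rule: strict_Sigma_strict_Pi.inducts)
    (auto intro: strict_Sigma_strict_Pi.intros)

lemma strict_Pi_mono: "m \<le> m' \<Longrightarrow> strict_Pi m A \<Longrightarrow> strict_Pi m' A"
  by (induction rule: dec_induct) (auto intro: strict_Sigma_Pi_Suc)

lemma Pi_class_mono: "m \<le> m' \<Longrightarrow> Pi_class L U m \<subseteq> Pi_class L U m'"
  by (auto simp: Pi_class_def intro: strict_Pi_mono)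

lemma bounded_strict_Pi: "bounded A \<Longrightarrow> strict_Pi m A"
  by (rule strict_Pi_mono[of 0]) (auto intro: strict_Sigma_strict_Pi.intros)

section \<open>Consistency operators and reflection\<close>

context provability_series
begin

sublocale wf_theory L U
  by unfold_locales (use U_sentences in \<open>auto simp: sentence_def\<close>)

lemma wf_dia: "wf_fm L A \<Longrightarrow> wf_fm L (dia D (Prv n) A)"
  by (simp add: dia_def box_def D_wf Prv_predicate)

lemma fv_dia: "wf_fm L A \<Longrightarrow> fv (dia D (Prv n) A) \<subseteq> fv A"
  using D_fv[of "Neg A"] Prv_predicate(2)[of n] by (auto simp: dia_def box_def)

lemma sentence_dia: "sentence L A \<Longrightarrow> sentence L (dia D (Prv n) A)"
  using wf_dia[of A n] fv_dia[of A n] by (auto simp: sentence_def)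

lemma sentence_Q: "sentence L \<phi> \<Longrightarrow> sentence L (Q D (Prv n) k \<phi>)"
proof (induction k)
  case 0
  then show ?case by (simp add: sentence_dia)
next
  case (Suc k)
  then have "sentence L (And \<phi> (Q D (Prv n) k \<phi>))" by (simp add: sentence_def)
  then show ?case by (simp add: sentence_dia)
qed

lemma dia_mono:
  assumes "Imp A B \<in> theorems L U"
  shows "Imp (dia D (Prv n) A) (dia D (Prv n) B) \<in> theorems L U"
proof -
  have wf: "wf_fm L (Neg B)" "wf_fm L (Neg A)" using wf_theorem[OF assms] by auto
  have "box D (Prv n) (Imp (Neg B) (Neg A)) \<in> theorems L U"
    using assms by (intro necessitation imp_contrapos)
  then have "Imp (box D (Prv n) (Neg B)) (box D (Prv n) (Neg A)) \<in> theorems L U"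
    using distribution[OF wf] closure.mp by blast
  then show ?thesis unfolding dia_def by (rule imp_contrapos)
qed

lemma Q_decreasing:
  assumes "sentence L \<phi>"
  shows "Imp (Q D (Prv n) (Suc k) \<phi>) (Q D (Prv n) k \<phi>) \<in> theorems L U"
proof -
  have wf: "wf_fm L \<phi>" using assms by (simp add: sentence_def)
  show ?thesis
    by (induction k) (use wf in \<open>auto intro!: dia_mono and_left and_mono wf_dia\<close>)
qed

lemma Q_Pi_class:
  assumes "sentence L \<phi>"
  shows "Q D (Prv n) k \<phi> \<in> Pi_class L U (Suc n)"
proof (cases k)
  case 0
  then show ?thesis using assms by (simp add: complexity sentence_def)
next
  case (Suc j)
  have "wf_fm L (And \<phi> (Q D (Prv n) j \<phi>))"
    using assms sentence_Q[OF assms] by (simp add: sentence_def)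
  then show ?thesis using Suc by (simp add: complexity)
qed

lemma Q_in_closure_RR:
  assumes "m > n" "sentence L \<phi>"
  shows "Q D (Prv n) k \<phi> \<in> closure L U (RR L U D (Prv n) m \<phi>)"
proof (induction k)
  case 0
  let ?Top = "Neg Bot :: ('f, 'p) fm"
  have wf: "wf_fm L \<phi>" using assms by (simp add: sentence_def)
  have top: "?Top \<in> theorems L U" by (rule imp_refl) simp
  have "strict_Pi m ?Top" by (intro bounded_strict_Pi bounded.intros)
  moreover have "Iff ?Top ?Top \<in> theorems L U" by (rule iff_refl) simp
  ultimately have "?Top \<in> Pi_class L U m" unfolding Pi_class_def by auto
  then have "dia D (Prv n) (And \<phi> ?Top) \<in> closure L U (RR L U D (Prv n) m \<phi>)"
    by (intro closure.rule[OF _ closure_mono[OF top]]) (auto simp: RR_def)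
  moreover have "Imp (dia D (Prv n) (And \<phi> ?Top)) (dia D (Prv n) \<phi>) \<in> theorems L U"
    using wf by (intro dia_mono and_left) auto
  ultimately show ?case
    by (auto intro: closure.mp closure_mono)
next
  case (Suc k)
  have "Q D (Prv n) k \<phi> \<in> Pi_class L U m"
    by (rule subsetD[OF Pi_class_mono Q_Pi_class]) (use assms in auto)
  then show ?case
    using Suc by (auto intro: closure.rule simp: RR_def)
qed

text \<open>The premise follows over \<open>U\<close> from a single iterate; the conclusion then follows from the
  next one, because an implication provable in \<open>U\<close> is preserved under the operator that forms
  the iterates. Hence \<open>\<psi>\<close> may have any complexity and any free variables.\<close>

lemma Q_theory_closed_under_RR:
  assumes "sentence L \<phi>" and "\<psi> \<in> theorems L (U \<union> range (\<lambda>k. Q D (Prv n) k \<phi>))"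
  shows "dia D (Prv n) (And \<phi> \<psi>) \<in> theorems L (U \<union> range (\<lambda>k. Q D (Prv n) k \<phi>))"
proof -
  obtain k where "Imp (Q D (Prv n) k \<phi>) \<psi> \<in> theorems L U"
    using chain_compactness[OF sentence_Q Q_decreasing assms(2)] assms(1) by blast
  then have "Imp (Q D (Prv n) (Suc k) \<phi>) (dia D (Prv n) (And \<phi> \<psi>)) \<in> theorems L U"
    using assms(1) by (auto intro!: dia_mono and_mono simp: sentence_def)
  then have "Imp (Q D (Prv n) (Suc k) \<phi>) (dia D (Prv n) (And \<phi> \<psi>))
      \<in> theorems L (U \<union> range (\<lambda>k. Q D (Prv n) k \<phi>))"
    by (rule closure_mono) auto
  then show ?thesis by (rule closure.mp) (rule closure.axiom, blast)
qed

lemma closure_RR_eq_Q_theory: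
  assumes "m > n" "sentence L \<phi>"
  shows "closure L U (RR L U D (Prv n) m \<phi>) = theorems L (U \<union> range (\<lambda>k. Q D (Prv n) k \<phi>))"
proof (intro equalityI subsetI)
  fix A assume "A \<in> closure L U (RR L U D (Prv n) m \<phi>)"
  then show "A \<in> theorems L (U \<union> range (\<lambda>k. Q D (Prv n) k \<phi>))"
  proof induction
    case (rule A B)
    then show ?case using Q_theory_closed_under_RR[OF assms(2)] by (auto simp: RR_def)
  qed (auto intro: closure.intros)
next
  fix A assume "A \<in> theorems L (U \<union> range (\<lambda>k. Q D (Prv n) k \<phi>))"
  then show "A \<in> closure L U (RR L U D (Prv n) m \<phi>)"
    by induction (auto intro: closure.intros Q_in_closure_RR[OF assms])
qed

end

theorem lemma3p7:
  fixes L :: "('f, 'p) lang"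
    and U :: "('f, 'p) fm set"
    and gn :: "('f, 'p) fm \<Rightarrow> nat"
    and D :: "('f, 'p) fm \<Rightarrow> ('f, 'p) fm"
    and Prv :: "nat \<Rightarrow> ('f, 'p) fm"
    and PrvE :: "('f, 'p) fm \<Rightarrow> nat \<Rightarrow> ('f, 'p) fm"
    and l m n :: nat
    and \<phi> :: "('f, 'p) fm"
  assumes "provability_series L U gn D Prv PrvE"
    and "l > n" and "m > n"
    and "sentence L \<phi>"
  shows "closure L U (RR L U D (Prv n) l \<phi>) = closure L U (RR L U D (Prv n) m \<phi>)
    \<and> closure L U (RR L U D (Prv n) m \<phi>) = theorems L (U \<union> {Q D (Prv n) k \<phi> | k. True})"
proof -
  interpret provability_series L U gn D Prv PrvE by (rule assms(1))
  show ?thesis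
    using closure_RR_eq_Q_theory[OF assms(2,4)] closure_RR_eq_Q_theory[OF assms(3,4)]
    by (simp add: full_SetCompr_eq)
qed

end
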